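(* Let $\Delta t>0$, $\beta>0$, $\mathcal J>0$, $n\ge 0$, let $(\mathbf X_i^n,\kappa_i^n)_{0\le i\le M-1}$, $q^n$ be given, and let $(\mathbf X_i^{n+1},V_i^{n+1},\kappa_i^{n+1})_{0\le i\le M-1}$, $q^{n+1}$ be a solution of the fully discrete A-RLM-BDF1-FDM scheme (equations (a)–(d) in the context). Then, with the relaxed energy $W_{\mathrm{RLM}}^n=W^n+\frac{q^n-1}{\beta}$, the discrete energy stability law $$\frac{W_{\mathrm{RLM}}^{n+1}-W_{\mathrm{RLM}}^n}{\Delta t}=-\sum_{i=0}^{M-1}(V_i^{n+1})^2\,|\delta_\rho\mathbf X_i^{n+1}|\,\Delta\rho\le 0$$ holds. In particular the scheme is unconditionally energy stable, i.e. $W_{\mathrm{RLM}}^{n+1}\le W_{\mathrm{RLM}}^n$ with no restriction on $\Delta t$.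
   Context: Grid: $M\in\mathbb N$, $h=\Delta\rho=1/M$, nodes $\rho_i=ih$, $i=0,\dots,M-1$, with all indices understood periodically modulo $M$. A discrete closed curve at time level $n$ is a family $\mathbf X_i^n\in\mathbb R^2$. For scalar or vector grid functions $f$, $$\delta_\rho f_i=\frac{f_{i+1}-f_{i-1}}{2h},\qquad \delta_{\rho\rho}f_i=\frac{f_{i+1}-2f_i+f_{i-1}}{h^2}.$$ Discrete unit tangent and normal: $\boldsymbol\tau_i^n=\delta_\rho\mathbf X_i^n/|\delta_\rho\mathbf X_i^n|$ and $\mathbf n_i^n=R\boldsymbol\tau_i^n$ with $R=\begin{pmatrix}0&-1\\1&0\end{pmatrix}$ (it is understood that $\delta_\rho \mathbf X_i^n\ne0$ whenever it is divided by). $M_{f,i}^{n+1}>0$ are the nodal values of a monitor function, $P_i^{n+1}>0$ are the nodal values of a smoothing coefficient, $\mathcal J>0$ is a relaxation time constant and $\beta>0$ a relaxation parameter. The relaxation variable is initialized with $q^0=1$. Discrete Willmore energy: $W^n=\frac12\sum_{i=0}^{M-1}(\kappa_i^n)^2|\delta_\rho\mathbf X_i^n|\,\Delta\rho$. Put $$\mu_i^{n+1}=\frac{\delta_{\rho\rho}\kappa_i^{n+1}}{|\delta_\rho\mathbf X_i^{n+1}|^2}-\frac{\delta_\rho\kappa_i^{n+1}\,(\delta_\rho\mathbf X_i^{n+1}\cdot\delta_{\rho\rho}\mathbf X_i^{n+1})}{|\delta_\rho\mathbf X_i^{n+1}|^4}+\frac12(\kappa_i^{n+1})^3 .$$ The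 A-RLM-BDF1-FDM scheme is: for all $i$, (a) $\displaystyle \frac{\mathbf X_i^{n+1}-\mathbf X_i^n}{\Delta t}=V_i^{n+1}\mathbf n_i^{n+1}+\left[\left(\frac{P_i^{n+1}M_{f,i}^{n+1}}{\mathcal J\,(M_{f,i}^{n+1}|\delta_\rho\mathbf X_i^{n+1}|)^2}\,\delta_{\rho\rho}\mathbf X_i^{n+1}\right)\cdot\boldsymbol\tau_i^{n+1}+\frac{P_i^{n+1}\,\delta_\rho M_{f,i}^{n+1}\,|\delta_\rho\mathbf X_i^{n+1}|}{\mathcal J\,(M_{f,i}^{n+1}|\delta_\rho\mathbf X_i^{n+1}|)^2}\right]\boldsymbol\tau_i^{n+1}$, (b) $V_i^{n+1}=q^{n+1}\mu_i^{n+1}$, (c) $\displaystyle\kappa_i^{n+1}=-\frac{\delta_{\rho\rho}\mathbf X_i^{n+1}\cdot\mathbf n_i^{n+1}}{|\delta_\rho\mathbf X_i^{n+1}|^2}$, (d) $\displaystyle\frac{q^{n+1}-q^n}{\Delta t}=-\beta\frac{W^{n+1}-W^n}{\Delta t}-\beta\, q^{n+1}\sum_{i=0}^{M-1}\mu_i^{n+1}\left(\frac{\mathbf X_i^{n+1}-\mathbf X_i^n}{\Delta t}\cdot\mathbf n_i^{n+1}\right)|\delta_\rho\mathbf X_i^{n+1}|\,\Delta\rho$. *)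

theory Defs
  imports "HOL-Analysis.Analysis"
begin

text \<open>
  A grid function on \<open>M\<close> nodes is a function on \<open>int\<close> of which only the values at \<open>0, \<dots>, M - 1\<close>
  matter. Periodicity of the indices is built into the difference operators by reducing the shifted
  index modulo \<open>M\<close>. Families indexed by the time level have the level as their first argument, so
  \<open>X n i\<close> is the node \<open>i\<close> of the curve at level \<open>n\<close>.
\<close>

definition step :: "nat \<Rightarrow> real" where
  "step M = 1 / real M"

definition \<delta>\<rho> :: "nat \<Rightarrow> (int \<Rightarrow> 'a::real_vector) \<Rightarrow> int \<Rightarrow> 'a" where
  "\<delta>\<rho> M f i = (f ((i + 1) mod int M) - f ((i - 1) mod int M)) /\<^sub>R (2 * step M)"

definition \<delta>\<rho>\<rho> :: "nat \<Rightarrow> (int \<Rightarrow> 'a::real_vector) \<Rightarrow> int \<Rightarrow> 'a" where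
  "\<delta>\<rho>\<rho> M f i =
     (f ((i + 1) mod int M) - 2 *\<^sub>R f (i mod int M) + f ((i - 1) mod int M)) /\<^sub>R (step M)\<^sup>2"

definition rot :: "real^2^2" where
  "rot = vector [vector [0, -1], vector [1, 0]]"

definition tangent :: "nat \<Rightarrow> (int \<Rightarrow> real^2) \<Rightarrow> int \<Rightarrow> real^2" where
  "tangent M X i = \<delta>\<rho> M X i /\<^sub>R norm (\<delta>\<rho> M X i)"

definition normal :: "nat \<Rightarrow> (int \<Rightarrow> real^2) \<Rightarrow> int \<Rightarrow> real^2" where
  "normal M X i = rot *v tangent M X i"

definition willmore :: "nat \<Rightarrow> (int \<Rightarrow> real^2) \<Rightarrow> (int \<Rightarrow> real) \<Rightarrow> real" where
  "willmore M X \<kappa> = 1/2 * (\<Sum>i\<in>{0..<int M}. (\<kappa> i)\<^sup>2 * norm (\<delta>\<rho> M X i) * step M)"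

definition relaxed_willmore ::
  "nat \<Rightarrow> real \<Rightarrow> (int \<Rightarrow> real^2) \<Rightarrow> (int \<Rightarrow> real) \<Rightarrow> real \<Rightarrow> real" where
  "relaxed_willmore M \<beta> X \<kappa> q = willmore M X \<kappa> + (q - 1) / \<beta>"

definition chem_pot :: "nat \<Rightarrow> (int \<Rightarrow> real^2) \<Rightarrow> (int \<Rightarrow> real) \<Rightarrow> int \<Rightarrow> real" where
  "chem_pot M X \<kappa> i =
     \<delta>\<rho>\<rho> M \<kappa> i / norm (\<delta>\<rho> M X i) ^ 2
     - \<delta>\<rho> M \<kappa> i * (\<delta>\<rho> M X i \<bullet> \<delta>\<rho>\<rho> M X i) / norm (\<delta>\<rho> M X i) ^ 4
     + 1/2 * (\<kappa> i) ^ 3"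

text \<open>
  The tangential velocity of the moving-mesh equation, for monitor values \<open>m\<close>, smoothing values
  \<open>p\<close> and relaxation time \<open>J\<close>.
\<close>

definition tangential_velocity ::
  "nat \<Rightarrow> real \<Rightarrow> (int \<Rightarrow> real) \<Rightarrow> (int \<Rightarrow> real) \<Rightarrow> (int \<Rightarrow> real^2) \<Rightarrow> int \<Rightarrow> real" where
  "tangential_velocity M J m p X i =
     ((p i * m i / (J * (m i * norm (\<delta>\<rho> M X i))\<^sup>2)) *\<^sub>R \<delta>\<rho>\<rho> M X i) \<bullet> tangent M X i
     + p i * \<delta>\<rho> M m i * norm (\<delta>\<rho> M X i) / (J * (m i * norm (\<delta>\<rho> M X i))\<^sup>2)"

text \<open>
  The A-RLM-BDF1-FDM scheme relates the levels \<open>n\<close> and \<open>n + 1\<close> only. Its four groups of equations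
  are the position update, the normal velocity, the discrete curvature, and the update of the
  relaxation variable \<open>q\<close>. The nodal values at level \<open>n\<close>, including \<open>\<kappa> n\<close>, are free data.
\<close>

definition rlm_bdf1_step ::
  "nat \<Rightarrow> real \<Rightarrow> real \<Rightarrow> real \<Rightarrow> (nat \<Rightarrow> int \<Rightarrow> real) \<Rightarrow> (nat \<Rightarrow> int \<Rightarrow> real) \<Rightarrow>
   (nat \<Rightarrow> int \<Rightarrow> real^2) \<Rightarrow> (nat \<Rightarrow> int \<Rightarrow> real) \<Rightarrow> (nat \<Rightarrow> int \<Rightarrow> real) \<Rightarrow> (nat \<Rightarrow> real) \<Rightarrow> nat \<Rightarrow> bool"
where
  "rlm_bdf1_step M \<Delta>t \<beta> J Mf P X V \<kappa> q n \<longleftrightarrow>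
     (\<forall>i\<in>{0..<int M}.
        (X (n + 1) i - X n i) /\<^sub>R \<Delta>t =
          V (n + 1) i *\<^sub>R normal M (X (n + 1)) i
          + tangential_velocity M J (Mf (n + 1)) (P (n + 1)) (X (n + 1)) i
              *\<^sub>R tangent M (X (n + 1)) i) \<and>
     (\<forall>i\<in>{0..<int M}. V (n + 1) i = q (n + 1) * chem_pot M (X (n + 1)) (\<kappa> (n + 1)) i) \<and>
     (\<forall>i\<in>{0..<int M}.
        \<kappa> (n + 1) i =
          - (\<delta>\<rho>\<rho> M (X (n + 1)) i \<bullet> normal M (X (n + 1)) i) / norm (\<delta>\<rho> M (X (n + 1)) i) ^ 2) \<and>
     (q (n + 1) - q n) / \<Delta>t =
       - \<beta> * (willmore M (X (n + 1)) (\<kappa> (n + 1)) - willmore M (X n) (\<kappa> n)) / \<Delta>t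
       - \<beta> * q (n + 1) *
           (\<Sum>i\<in>{0..<int M}.
              chem_pot M (X (n + 1)) (\<kappa> (n + 1)) i
              * (((X (n + 1) i - X n i) /\<^sub>R \<Delta>t) \<bullet> normal M (X (n + 1)) i)
              * norm (\<delta>\<rho> M (X (n + 1)) i) * step M)"

end

theory Submission
  imports Defs
begin

text \<open>
  The relaxation equation says that the rate of change of \<open>q / \<beta>\<close> is minus that of the Willmore
  energy, minus the power of the relaxed chemical potential \<open>q\<^sup>n\<^sup>+\<^sup>1 \<mu>\<close> along the discrete normal
  velocity. In the relaxed energy the Willmore differences
  therefore cancel identically and only the power term is left. Its summands are squares: the tangent
  and the normal are orthonormal at a node with nonvanishing difference quotient, so the tangential
  motion of the mesh drops out and the normal component of the position update is \<open>V\<close> (lemma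
  \<open>inner_normal_moving_frame\<close>), while the velocity law says that \<open>q\<^sup>n\<^sup>+\<^sup>1 \<mu>\<close> is \<open>V\<close> as well.
\<close>

lemma tangent_inner_normal: "tangent M X i \<bullet> normal M X i = 0"
  by (simp add: normal_def rot_def inner_vec_def matrix_vector_mult_def sum_2)

lemma normal_inner_normal:
  assumes "\<delta>\<rho> M X i \<noteq> 0"
  shows "normal M X i \<bullet> normal M X i = 1"
proof -
  have "normal M X i \<bullet> normal M X i = tangent M X i \<bullet> tangent M X i"
    by (simp add: normal_def rot_def inner_vec_def matrix_vector_mult_def sum_2)
  also have "\<dots> = (norm (tangent M X i))\<^sup>2"
    by (rule dot_square_norm)
  also have "\<dots> = 1"
    using assms by (simp add: tangent_def)
  finally show ?thesis .
qed

lemma inner_normal_moving_frame: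
  assumes "\<delta>\<rho> M X i \<noteq> 0"
  shows "(v *\<^sub>R normal M X i + w *\<^sub>R tangent M X i) \<bullet> normal M X i = v"
  using assms by (simp add: inner_add_left normal_inner_normal tangent_inner_normal)

theorem theorem4p2:
  fixes M n :: nat
    and \<Delta>t \<beta> J :: real
    and Mf P V \<kappa> :: "nat \<Rightarrow> int \<Rightarrow> real"
    and X :: "nat \<Rightarrow> int \<Rightarrow> real^2"
    and q :: "nat \<Rightarrow> real"
  assumes "M > 0" and "\<Delta>t > 0" and "\<beta> > 0" and "J > 0"
    and "\<forall>i\<in>{0..<int M}. Mf (n + 1) i > 0"
    and "\<forall>i\<in>{0..<int M}. P (n + 1) i > 0"
    and "q 0 = 1"
    and "\<forall>i\<in>{0..<int M}. \<delta>\<rho> M (X (n + 1)) i \<noteq> 0"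
    and "rlm_bdf1_step M \<Delta>t \<beta> J Mf P X V \<kappa> q n"
  shows "(relaxed_willmore M \<beta> (X (n + 1)) (\<kappa> (n + 1)) (q (n + 1))
            - relaxed_willmore M \<beta> (X n) (\<kappa> n) (q n)) / \<Delta>t
           = - (\<Sum>i\<in>{0..<int M}. (V (n + 1) i)\<^sup>2 * norm (\<delta>\<rho> M (X (n + 1)) i) * step M) \<and>
         - (\<Sum>i\<in>{0..<int M}. (V (n + 1) i)\<^sup>2 * norm (\<delta>\<rho> M (X (n + 1)) i) * step M) \<le> 0 \<and>
         relaxed_willmore M \<beta> (X (n + 1)) (\<kappa> (n + 1)) (q (n + 1))
           \<le> relaxed_willmore M \<beta> (X n) (\<kappa> n) (q n)"
proof -
  let ?\<mu> = "chem_pot M (X (n + 1)) (\<kappa> (n + 1))"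
  let ?d = "\<lambda>i. ((X (n + 1) i - X n i) /\<^sub>R \<Delta>t) \<bullet> normal M (X (n + 1)) i"
  let ?l = "\<lambda>i. norm (\<delta>\<rho> M (X (n + 1)) i)"
  let ?S = "\<Sum>i\<in>{0..<int M}. ?\<mu> i * ?d i * ?l i * step M"
  let ?D = "\<Sum>i\<in>{0..<int M}. (V (n + 1) i)\<^sup>2 * ?l i * step M"
  let ?W = "\<lambda>k. willmore M (X k) (\<kappa> k)"
  let ?E = "\<lambda>k. relaxed_willmore M \<beta> (X k) (\<kappa> k) (q k)"
  have velocity: "?d i = V (n + 1) i" "V (n + 1) i = q (n + 1) * ?\<mu> i"
    if "i \<in> {0..<int M}" for i
    using that assms(8,9) inner_normal_moving_frame[of M "X (n + 1)" i]
    by (simp_all add: rlm_bdf1_step_def)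
  have power: "q (n + 1) * ?S = ?D"
    unfolding sum_distrib_left
  proof (rule sum.cong)
    fix i assume i: "i \<in> {0..<int M}"
    have "q (n + 1) * (?\<mu> i * ?d i * ?l i * step M) = (q (n + 1) * ?\<mu> i) * ?d i * ?l i * step M"
      by (simp only: mult.assoc)
    also have "\<dots> = (V (n + 1) i)\<^sup>2 * ?l i * step M"
      by (simp only: velocity(1)[OF i] velocity(2)[OF i, symmetric] power2_eq_square)
    finally show "q (n + 1) * (?\<mu> i * ?d i * ?l i * step M) = (V (n + 1) i)\<^sup>2 * ?l i * step M" .
  qed simp
  have "(q (n + 1) - q n) / \<Delta>t = - \<beta> * (?W (n + 1) - ?W n) / \<Delta>t - \<beta> * q (n + 1) * ?S"
    using assms(9) unfolding rlm_bdf1_step_def by blast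
  then have relax: "(q (n + 1) - q n) / \<Delta>t = - \<beta> * (?W (n + 1) - ?W n) / \<Delta>t - \<beta> * ?D"
    unfolding power[symmetric] by (simp only: mult.assoc)
  have "(?E (n + 1) - ?E n) / \<Delta>t
      = (?W (n + 1) - ?W n) / \<Delta>t + (q (n + 1) - q n) / \<Delta>t / \<beta>"
    using assms(2,3) by (simp add: relaxed_willmore_def field_simps)
  also have "\<dots> = - ?D"
    unfolding relax using assms(3) by (simp add: diff_divide_distrib)
  finally have law: "(?E (n + 1) - ?E n) / \<Delta>t = - ?D" .
  have dissipation: "- ?D \<le> 0"
    by (simp add: sum_nonneg step_def)
  have "(?E (n + 1) - ?E n) / \<Delta>t \<le> 0"
    unfolding law by (rule dissipation)
  then have "?E (n + 1) - ?E n \<le> 0"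
    using assms(2) by (simp add: divide_le_0_iff)
  with law dissipation show ?thesis
    by simp
qed

end
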